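(* For every finite group $G$, the restricted wreath product of $G$ by $\mathbb{Z}$ is graph automatic.
   Context: The restricted wreath product of $G$ by $\mathbb{Z}$ is the group of all pairs $(i,f)$ with $i\in\mathbb{Z}$ and $f:\mathbb{Z}\to G$ a function with $f(j)=1_G$ for all but finitely many $j$, with multiplication $(i,f)\cdot(i_1,f_1)=(i+i_1,\alpha_{i_1}(f)f_1)$, where $\alpha_c(f)(j)=f(j+c)$ and functions are multiplied pointwise. For a finite alphabet $\Sigma$, let $\Sigma^\star$ be the set of finite strings over $\Sigma$. For strings $w_1,\dots,w_n\in\Sigma^\star$ the convolution $\otimes(w_1,\dots,w_n)$ is the string of length $\max_i|w_i|$ over the alphabet $(\Sigma\cup\{\diamond\})^n$ (with $\diamond\notin\Sigma$) whose $k$-th symbol is $(\sigma_1,\dots,\sigma_n)$, where $\sigma_i$ is the $k$-th symbol of $w_i$ if $k\le|w_i|$ and $\sigma_i=\diamond$ otherwise. A relation $R\subseteq(\Sigma^\star)^n$ is FA recognizable if $\{\otimes(w_1,\dots,w_n)\mid (w_1,\dots,w_n)\in R\}$ is a regular language (recognized by a finite automaton). Let $G$ be a group generated by a finite set $X$. Its Cayley graph $\Gamma(G,X)$ is viewed as the structure $(G;(E_x)_{x\in X})$ with $E_x=\{(g,gx)\mid g\in G\}$. The group $G$ is graph automatic with respect to $X$ if there are a finite alphabet $\Sigma$, a regular language $R\subseteq\Sigma^\star$ and a bijection $\nu:R\to G$ such that for each $x\in X$ the relation $\{(u,v)\in R^2\mid \nu(u)x=\nu(v)\}$ is FA recognizable.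 A finitely generated group is graph automatic if it is graph automatic with respect to some finite generating set. *)

theory Defs
  imports "HOL-Algebra.Generated_Groups"
begin

definition restricted_wreath_int ::
  "('a, 'b) monoid_scheme \<Rightarrow> (int \<times> (int \<Rightarrow> 'a)) monoid" where
  "restricted_wreath_int G =
     \<lparr>carrier = {(i, f). (\<forall>j. f j \<in> carrier G) \<and> finite {j. f j \<noteq> \<one>\<^bsub>G\<^esub>}},
      monoid.mult = (\<lambda>(i, f) (i1, f1). (i + i1, \<lambda>j. f (j + i1) \<otimes>\<^bsub>G\<^esub> f1 j)),
      one = (0, \<lambda>_. \<one>\<^bsub>G\<^esub>)\<rparr>"

text \<open>Automata may be nondeterministic. A transition \<open>(q, a, q')\<close> reads the letter \<open>a\<close> in
  state \<open>q\<close> and moves to \<open>q'\<close>.\<close>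

primrec fa_reach :: "('s \<times> 'a \<times> 's) set \<Rightarrow> 's set \<Rightarrow> 'a list \<Rightarrow> 's set" where
  "fa_reach \<Delta> S [] = S"
| "fa_reach \<Delta> S (a # w) = fa_reach \<Delta> {q'. \<exists>q\<in>S. (q, a, q') \<in> \<Delta>} w"

text \<open>Only finitely many states occur, so taking them to be natural numbers loses nothing.\<close>

definition regular_language :: "'a set \<Rightarrow> 'a list set \<Rightarrow> bool" where
  "regular_language A L \<longleftrightarrow> finite A \<and>
     (\<exists>(Q :: nat set) I \<Delta> F. finite Q \<and> I \<subseteq> Q \<and> F \<subseteq> Q \<and> \<Delta> \<subseteq> Q \<times> A \<times> Q \<and>
        L = {w \<in> lists A. fa_reach \<Delta> I w \<inter> F \<noteq> {}})"

text \<open>A tuple of words is a list of words, a letter of a convolution is a list of padded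
  letters, and \<open>None\<close> is the padding symbol. Positions count from \<open>0\<close>.\<close>

definition convolution :: "'a list list \<Rightarrow> 'a option list list" where
  "convolution ws =
     map (\<lambda>k. map (\<lambda>w. if k < length w then Some (w ! k) else None) ws)
       [0..<Max (insert 0 (length ` set ws))]"

definition conv_alphabet :: "'a set \<Rightarrow> nat \<Rightarrow> 'a option list set" where
  "conv_alphabet A n = {s. length s = n \<and> set s \<subseteq> insert None (Some ` A)}"

definition FA_recognizable :: "'a set \<Rightarrow> nat \<Rightarrow> 'a list list set \<Rightarrow> bool" where
  "FA_recognizable A n R \<longleftrightarrow>
     R \<subseteq> {ws. length ws = n \<and> set ws \<subseteq> lists A} \<and>
     regular_language (conv_alphabet A n) (convolution ` R)"

text \<open>The alphabet is finite, so it may be taken to be a finite set of natural numbers; HOL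
  cannot quantify existentially over its type.\<close>

definition graph_automatic_wrt :: "('g, 'b) monoid_scheme \<Rightarrow> 'g set \<Rightarrow> bool" where
  "graph_automatic_wrt G X \<longleftrightarrow>
     group G \<and> finite X \<and> X \<subseteq> carrier G \<and> generate G X = carrier G \<and>
     (\<exists>(A :: nat set) R \<nu>. finite A \<and> regular_language A R \<and> bij_betw \<nu> R (carrier G) \<and>
        (\<forall>x\<in>X. FA_recognizable A 2 {[u, v] | u v. u \<in> R \<and> v \<in> R \<and> \<nu> u \<otimes>\<^bsub>G\<^esub> x = \<nu> v}))"

definition graph_automatic :: "('g, 'b) monoid_scheme \<Rightarrow> bool" where
  "graph_automatic G \<longleftrightarrow> (\<exists>X. graph_automatic_wrt G X)"

end

theory Submission
  imports Defs
begin

text \<open>Encode \<open>(i, f)\<close> by the sequence \<open>j \<mapsto> (f (j - i), j < i)\<close> over the integers. Right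
  multiplication by \<open>(1, 1)\<close> keeps the first components and moves the flag by one place, and right
  multiplication by an element supported at \<open>0\<close> changes the entry at the first position without
  flag. So both the set of codes and the edges of the Cayley graph are given by conditions on
  consecutive entries. The sequences are constant near both ends; folding them at \<open>0\<close> and
  stripping the trailing default letter turns them into finite words, and conditions on consecutive
  letters of a (convolution of) words are checked by automata whose state is the last letter.\<close>

section \<open>Local languages\<close>

lemma fa_reach_empty [simp]: "fa_reach \<Delta> {} w = {}"
  by (induction w) auto

text \<open>The automaton remembers only the last letter read: state \<open>0\<close> stands for the
  beginning, and \<open>Suc (f a)\<close> for having just read \<open>a\<close>. A violation of
  \<open>I\<close> or \<open>P\<close> has no transition, so the run dies. The empty word has no
  first or last letter, hence the separate flag \<open>e\<close>.\<close>

lemma regular_local: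
  assumes "finite A"
  shows "regular_language A
    {w \<in> lists A. if w = [] then e else I (hd w) \<and> successively P w \<and> E (last w)}"
proof -
  obtain f :: "'a \<Rightarrow> nat" where f: "inj_on f A"
    using assms finite_imp_inj_to_nat_seg by metis
  define Q where "Q = insert 0 ((\<lambda>a. Suc (f a)) ` A)"
  define \<Delta> where "\<Delta> = (\<lambda>a. (0, a, Suc (f a))) ` {a \<in> A. I a}
      \<union> (\<lambda>(a, b). (Suc (f a), b, Suc (f b))) ` {(a, b). a \<in> A \<and> b \<in> A \<and> P a b}"
  define F where "F = (if e then {0} else {}) \<union> (\<lambda>a. Suc (f a)) ` {a \<in> A. E a}"
  have step0: "{q'. \<exists>q\<in>{0}. (q, a, q') \<in> \<Delta>} = (if I a then {Suc (f a)} else {})"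
    if "a \<in> A" for a
    using that by (auto simp: \<Delta>_def)
  have step: "{q'. \<exists>q\<in>{Suc (f a)}. (q, b, q') \<in> \<Delta>} = (if P a b then {Suc (f b)} else {})"
    if "a \<in> A" "b \<in> A" for a b
    using that f by (auto simp: \<Delta>_def inj_on_eq_iff)
  \<comment> \<open>From a single state at most one state survives each letter, so the reachable set
    is a singleton or empty.\<close>
  have run: "fa_reach \<Delta> {Suc (f a)} w =
      (if successively P (a # w) then {Suc (f (last (a # w)))} else {})"
    if "a \<in> A" "w \<in> lists A" for a w
    using that
  proof (induction w arbitrary: a)
    case (Cons b w)
    then have "fa_reach \<Delta> {Suc (f a)} (b # w) =
        fa_reach \<Delta> (if P a b then {Suc (f b)} else {}) w"
      using step[of a b] by simp
    with Cons show ?case by auto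
  qed simp
  have acc: "fa_reach \<Delta> {0} w \<inter> F \<noteq> {} \<longleftrightarrow>
      (if w = [] then e else I (hd w) \<and> successively P w \<and> E (last w))"
    if "w \<in> lists A" for w
  proof (cases w)
    case Nil
    then show ?thesis by (auto simp: F_def)
  next
    case (Cons a v)
    with that have *: "a \<in> A" "v \<in> lists A" "last (a # v) \<in> A"
      by (auto simp: subset_iff)
    then have "fa_reach \<Delta> {0} w = (if I a \<and> successively P w then {Suc (f (last w))} else {})"
      using step0[of a] run[of a v] Cons by auto
    moreover have "Suc (f (last w)) \<in> F \<longleftrightarrow> E (last w)"
      using * f Cons by (auto simp: F_def inj_on_eq_iff)
    ultimately show ?thesis using Cons by auto
  qed
  have "finite Q" "{0} \<subseteq> Q" "F \<subseteq> Q" "\<Delta> \<subseteq> Q \<times> A \<times> Q"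
    using assms by (auto simp: Q_def F_def \<Delta>_def)
  moreover have "{w \<in> lists A. if w = [] then e else I (hd w) \<and> successively P w \<and> E (last w)} =
      {w \<in> lists A. fa_reach \<Delta> {0} w \<inter> F \<noteq> {}}"
    using acc by (intro Collect_cong conj_cong refl) simp
  ultimately show ?thesis
    unfolding regular_language_def using assms by blast
qed

section \<open>Eventually constant sequences as words without trailing default letter\<close>

definition pad :: "'a \<Rightarrow> 'a list \<Rightarrow> nat \<Rightarrow> 'a" where
  "pad d w k = (if k < length w then w ! k else d)"

definition normal_words :: "'a set \<Rightarrow> 'a \<Rightarrow> 'a list set" where
  "normal_words A d = {w \<in> lists A. w = [] \<or> last w \<noteq> d}"

text \<open>Trailing default letters are the only ambiguity of padding. Once they are excluded, the
  length of the word is recovered from the sequence as one past its last non-default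
  position.\<close>

lemma bij_betw_pad:
  assumes "d \<in> A"
  shows "bij_betw (pad d) (normal_words A d) {s. range s \<subseteq> A \<and> finite {k. s k \<noteq> d}}"
proof (rule bij_betw_imageI)
  show "inj_on (pad d) (normal_words A d)"
  proof (rule inj_onI)
    fix u v assume uv: "u \<in> normal_words A d" "v \<in> normal_words A d" "pad d u = pad d v"
    \<comment> \<open>If \<open>u\<close> were longer, its last letter, which is not
      \<open>d\<close>, would face the padding of \<open>v\<close>.\<close>
    have le: "length u \<le> length v"
      if "u \<in> normal_words A d" "pad d u = pad d v" for u v :: "'a list"
    proof (rule ccontr)
      assume "\<not> length u \<le> length v"
      then have "u \<noteq> []" and "length v \<le> length u - 1" by auto
      moreover have "pad d u (length u - 1) = last u"
        using \<open>u \<noteq> []\<close> by (simp add: pad_def last_conv_nth)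
      moreover have "pad d v (length u - 1) = d"
        using \<open>length v \<le> length u - 1\<close> by (simp add: pad_def)
      ultimately show False using that by (auto simp: normal_words_def)
    qed
    have "length u = length v" using le uv by (metis le_antisym)
    moreover have "u ! k = v ! k" if "k < length u" for k
      using fun_cong[OF uv(3), of k] that calculation by (simp add: pad_def)
    ultimately show "u = v" by (rule nth_equalityI)
  qed
  show "pad d ` normal_words A d = {s. range s \<subseteq> A \<and> finite {k. s k \<noteq> d}}"
  proof (intro equalityI subsetI)
    fix s assume "s \<in> pad d ` normal_words A d"
    then obtain w where w: "w \<in> lists A" "s = pad d w"
      by (auto simp: normal_words_def)
    have "{k. s k \<noteq> d} \<subseteq> {..<length w}"
      by (auto simp: w pad_def split: if_splits)
    then have "finite {k. s k \<noteq> d}" by (rule finite_subset) simp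
    moreover have "range s \<subseteq> A"
      using w assms by (auto simp: pad_def)
    ultimately show "s \<in> {s. range s \<subseteq> A \<and> finite {k. s k \<noteq> d}}" by simp
  next
    fix s :: "nat \<Rightarrow> 'a" assume s: "s \<in> {s. range s \<subseteq> A \<and> finite {k. s k \<noteq> d}}"
    \<comment> \<open>One past the last non-default position; the inserted \<open>0\<close> makes
      the constant sequence come from the empty word.\<close>
    define n where "n = Max (insert 0 (Suc ` {k. s k \<noteq> d}))"
    have ge: "s k = d" if "n \<le> k" for k
    proof (rule ccontr)
      assume "s k \<noteq> d"
      then have "Suc k \<le> n" unfolding n_def using s by (intro Max_ge) auto
      then show False using that by simp
    qed
    have "n \<in> insert 0 (Suc ` {k. s k \<noteq> d})"
      unfolding n_def using s by (intro Max_in) auto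
    then have "map s [0..<n] = [] \<or> last (map s [0..<n]) \<noteq> d"
      by (auto simp: last_map)
    then have "map s [0..<n] \<in> normal_words A d"
      using s by (auto simp: normal_words_def image_subset_iff)
    moreover have "pad d (map s [0..<n]) = s"
      using ge by (auto simp: pad_def fun_eq_iff)
    ultimately show "s \<in> pad d ` normal_words A d" by (metis imageI)
  qed
qed

text \<open>The infinitely many conditions on the padded sequence collapse to conditions inside the
  word, one at the step from the last letter into the padding, and \<open>P d d\<close> within the
  padding. This is an instance of \<open>regular_local\<close>.\<close>

lemma regular_pad_local:
  assumes "finite A"
  shows "regular_language A
    {w \<in> normal_words A d. I (pad d w 0) \<and> (\<forall>k. P (pad d w k) (pad d w (Suc k)))}"
proof -
  have "{w \<in> normal_words A d. I (pad d w 0) \<and> (\<forall>k. P (pad d w k) (pad d w (Suc k)))} =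
    {w \<in> lists A. if w = [] then I d \<and> P d d
      else I (hd w) \<and> successively P w \<and> (last w \<noteq> d \<and> P (last w) d \<and> P d d)}"
    (is "?L = ?R")
  proof -
    have "w \<in> ?L \<longleftrightarrow> w \<in> ?R" for w
    proof (cases "w = []")
      case True
      then show ?thesis by (auto simp: normal_words_def pad_def)
    next
      case False
      have "(\<forall>k. P (pad d w k) (pad d w (Suc k))) \<longleftrightarrow>
          successively P w \<and> P (last w) d \<and> P d d" (is "?l \<longleftrightarrow> ?r")
      proof
        assume l: ?l
        have "successively P w"
          unfolding successively_conv_nth
        proof (intro allI impI)
          fix i assume "Suc i < length w"
          then show "P (w ! i) (w ! Suc i)" using spec[OF l, of i] by (simp add: pad_def)
        qed
        moreover have "P (last w) d"
          using spec[OF l, of "length w - 1"] False by (simp add: pad_def last_conv_nth)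
        moreover have "P d d"
          using spec[OF l, of "length w"] by (simp add: pad_def)
        ultimately show ?r by simp
      next
        assume r: ?r
        show ?l
        proof
          fix k
          consider "Suc k < length w" | "k = length w - 1" | "length w \<le> k" by linarith
          then show "P (pad d w k) (pad d w (Suc k))"
            using r False by cases (auto simp: pad_def successively_conv_nth last_conv_nth)
        qed
      qed
      with False show ?thesis by (auto simp: normal_words_def pad_def hd_conv_nth)
    qed
    then show ?thesis by blast
  qed
  then show ?thesis
    using regular_local[OF assms, of "I d \<and> P d d" I P "\<lambda>x. x \<noteq> d \<and> P x d \<and> P d d"] by simp
qed

section \<open>Convolutions of pairs\<close>

text \<open>Unlike \<open>pad\<close>, this keeps the end of the word visible, as one track of a
  convolution does.\<close>

definition nth_option :: "'a list \<Rightarrow> nat \<Rightarrow> 'a option" where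
  "nth_option w k = (if k < length w then Some (w ! k) else None)"

definition option_default :: "'a \<Rightarrow> 'a option \<Rightarrow> 'a" where
  "option_default d x = (case x of None \<Rightarrow> d | Some a \<Rightarrow> a)"

lemma option_default_nth_option: "option_default d (nth_option w k) = pad d w k"
  by (simp add: option_default_def nth_option_def pad_def)

lemma convolution_pair:
  "convolution [u, v] =
    map (\<lambda>k. [nth_option u k, nth_option v k]) [0..<max (length u) (length v)]"
  by (simp add: convolution_def nth_option_def max.commute)

lemma convolution_pair_simps:
  "convolution [[], []] = []"
  "convolution [a # u, b # v] = [Some a, Some b] # convolution [u, v]"
  "convolution [a # u, []] = [Some a, None] # convolution [u, []]"
  "convolution [[], b # v] = [None, Some b] # convolution [[], v]"
  by (simp_all add: convolution_pair nth_option_def upt_conv_Cons map_Suc_upt[symmetric] comp_def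
      del: upt_Suc)

text \<open>Once padding starts in a track it persists, so each track is a word followed by padding
  only; with no letter consisting of padding alone, the longer track has full length. Induction
  builds the two words letter by letter.\<close>

lemma convolution_pair_exists:
  assumes "w \<in> lists (conv_alphabet A 2)"
    and "\<And>x. x \<in> set w \<Longrightarrow> x \<noteq> [None, None]"
    and "successively (\<lambda>x y. \<forall>i<2. x ! i = None \<longrightarrow> y ! i = None) w"
  shows "\<exists>u\<in>lists A. \<exists>v\<in>lists A. w = convolution [u, v]"
  using assms
proof (induction w rule: list.induct)
  case Nil
  then show ?case by (metis convolution_pair_simps(1) lists.Nil)
next
  case (Cons x w)
  have "\<exists>u\<in>lists A. \<exists>v\<in>lists A. w = convolution [u, v]"
  proof (rule Cons.IH)
    show "w \<in> lists (conv_alphabet A 2)" using Cons.prems(1) by simp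
    show "x \<noteq> [None, None]" if "x \<in> set w" for x using Cons.prems(2) that by simp
    show "successively (\<lambda>x y. \<forall>i<2. x ! i = None \<longrightarrow> y ! i = None) w"
      using Cons.prems(3) by (cases w) auto
  qed
  then obtain u v where uv: "u \<in> lists A" "v \<in> lists A" "w = convolution [u, v]"
    by blast
  obtain a b where x: "x = [a, b]" and ab: "a \<in> insert None (Some ` A)" "b \<in> insert None (Some ` A)"
    using Cons.prems(1) by (auto simp: conv_alphabet_def length_Suc_conv numeral_2_eq_2)
  \<comment> \<open>A letter of \<open>u\<close> would stand in the first letter of
    \<open>w\<close>, directly after padding in the same track.\<close>
  have u: "u = []" if "a = None"
    using Cons.prems(3) that uv(3) x
    by (cases u; cases v) (auto simp: convolution_pair_simps numeral_2_eq_2 All_less_Suc)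
  have v: "v = []" if "b = None"
    using Cons.prems(3) that uv(3) x
    by (cases u; cases v) (auto simp: convolution_pair_simps numeral_2_eq_2 All_less_Suc)
  show ?case
  proof (cases a)
    case None
    then obtain b' where "b = Some b'" "b' \<in> A"
      using ab Cons.prems(2)[of x] x by auto
    then have "x # w = convolution [[], b' # v]" "b' # v \<in> lists A"
      using u None uv x by (auto simp: convolution_pair_simps)
    then show ?thesis by blast
  next
    case (Some a')
    then have a': "a' # u \<in> lists A" using ab uv by auto
    show ?thesis
    proof (cases b)
      case None
      then have "x # w = convolution [a' # u, []]"
        using v Some uv x by (auto simp: convolution_pair_simps)
      then show ?thesis using a' by blast
    next
      case (Some b')
      then have "x # w = convolution [a' # u, b' # v]" "b' # v \<in> lists A"
        using \<open>a = Some a'\<close> ab uv x by (auto simp: convolution_pair_simps)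
      then show ?thesis using a' by blast
    qed
  qed
qed

lemma pad_convolution_pair:
  "pad [None, None] (convolution [u, v]) k = [nth_option u k, nth_option v k]"
  by (auto simp: pad_def convolution_pair nth_option_def)

lemma convolution_pair_normal_words:
  assumes "u \<in> lists A" "v \<in> lists A"
  shows "convolution [u, v] \<in> normal_words (conv_alphabet A 2) [None, None]"
proof -
  have "last (convolution [u, v]) \<noteq> [None, None]" if "convolution [u, v] \<noteq> []"
    using that by (auto simp: convolution_pair last_map nth_option_def max_def split: if_splits)
  moreover have "convolution [u, v] \<in> lists (conv_alphabet A 2)"
    using assms by (auto simp: convolution_pair nth_option_def conv_alphabet_def)
  ultimately show ?thesis by (auto simp: normal_words_def)
qed

text \<open>Expresses the condition on the last letter through consecutive positions. It can then be
  checked in each track of a convolution, although the tracks may end at different places.\<close>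

lemma normal_words_iff_nth_option:
  assumes "w \<in> lists A"
  shows "w \<in> normal_words A d \<longleftrightarrow>
    (\<forall>k. nth_option w (Suc k) = None \<longrightarrow> nth_option w k \<noteq> Some d)"
proof (cases "w = []")
  case True
  then show ?thesis by (simp add: normal_words_def nth_option_def)
next
  case False
  have "(\<forall>k. nth_option w (Suc k) = None \<longrightarrow> nth_option w k \<noteq> Some d) \<longleftrightarrow> last w \<noteq> d" (is "?l \<longleftrightarrow> ?r")
  proof
    assume l: ?l
    show ?r using spec[OF l, of "length w - 1"] False
      by (simp add: nth_option_def last_conv_nth)
  next
    assume r: ?r
    show ?l
    proof (intro allI impI)
      fix k assume "nth_option w (Suc k) = None"
      then have "length w \<le> k \<or> k = length w - 1" by (auto simp: nth_option_def split: if_splits)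
      then show "nth_option w k \<noteq> Some d"
        using r False by (auto simp: nth_option_def last_conv_nth)
    qed
  qed
  then show ?thesis using assms False by (auto simp: normal_words_def)
qed

lemma finite_conv_alphabet:
  assumes "finite A"
  shows "finite (conv_alphabet A n)"
proof -
  have "conv_alphabet A n = {s. set s \<subseteq> insert None (Some ` A) \<and> length s = n}"
    by (auto simp: conv_alphabet_def)
  then show ?thesis using assms by (simp add: finite_lists_length_eq)
qed

text \<open>The convolutions of related pairs form a language of the kind treated in
  \<open>regular_pad_local\<close>, now over the pair alphabet with default letter
  \<open>[None, None]\<close>.\<close>

lemma FA_recognizable_pad_local:
  assumes "finite A"
  shows "FA_recognizable A 2 {[u, v] | u v. u \<in> normal_words A d \<and> v \<in> normal_words A d \<and>
    I (pad d u 0, pad d v 0) \<and>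
    (\<forall>k. P (pad d u k, pad d v k) (pad d u (Suc k), pad d v (Suc k)))}"
    (is "FA_recognizable A 2 ?R")
proof -
  \<comment> \<open>\<open>val\<close> reads padding as the default letter \<open>d\<close>.
    \<open>N\<close> demands in each track that padding persists and never starts right after
    \<open>d\<close>, so that both tracks are normal words.\<close>
  define val where "val x = (option_default d (x ! 0), option_default d (x ! 1))"
    for x :: "'a option list"
  define N where "N x y \<longleftrightarrow>
      (\<forall>i<2. (x ! i = None \<longrightarrow> y ! i = None) \<and> (y ! i = None \<longrightarrow> x ! i \<noteq> Some d))"
    for x y :: "'a option list"
  define B where "B = conv_alphabet A 2"
  define L where "L = {w \<in> normal_words B [None, None]. I (val (pad [None, None] w 0)) \<and>
      (\<forall>k. N (pad [None, None] w k) (pad [None, None] w (Suc k)) \<and>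
           P (val (pad [None, None] w k)) (val (pad [None, None] w (Suc k))))}"
  have L: "convolution [u, v] \<in> L \<longleftrightarrow> [u, v] \<in> ?R" if uv: "u \<in> lists A" "v \<in> lists A" for u v
  proof -
    have "(\<forall>k. N [nth_option u k, nth_option v k] [nth_option u (Suc k), nth_option v (Suc k)]) \<longleftrightarrow>
        u \<in> normal_words A d \<and> v \<in> normal_words A d"
      unfolding normal_words_iff_nth_option[OF uv(1)] normal_words_iff_nth_option[OF uv(2)]
      by (auto simp: N_def less_2_cases_iff nth_option_def all_conj_distrib)
    then show ?thesis
      using convolution_pair_normal_words[OF uv]
      by (auto simp: L_def B_def pad_convolution_pair val_def option_default_nth_option
          all_conj_distrib)
  qed
  have ex: "\<exists>u\<in>lists A. \<exists>v\<in>lists A. w = convolution [u, v]" if "w \<in> L" for w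
  proof (rule convolution_pair_exists)
    have w: "w \<in> lists B" "w = [] \<or> last w \<noteq> [None, None]"
      and N: "\<And>k. N (pad [None, None] w k) (pad [None, None] w (Suc k))"
      using that by (auto simp: L_def normal_words_def)
    show "w \<in> lists (conv_alphabet A 2)" using w B_def by simp
    have Nw: "N (w ! k) (w ! Suc k)" if "Suc k < length w" for k
      using N[of k] that by (simp add: pad_def)
    then show "successively (\<lambda>x y. \<forall>i<2. x ! i = None \<longrightarrow> y ! i = None) w"
      by (auto simp: successively_conv_nth N_def)
    show "x \<noteq> [None, None]" if "x \<in> set w" for x
    proof
      assume "x = [None, None]"
      with that obtain k where k: "k < length w" "w ! k = [None, None]"
        by (auto simp: in_set_conv_nth)
      \<comment> \<open>By \<open>N\<close> a letter of padding alone would propagate to the last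
        letter, which normality of \<open>w\<close> forbids.\<close>
      have "\<forall>i<2. w ! m ! i = None" if "k \<le> m" "m < length w" for m
        using that
      proof (induction m rule: dec_induct)
        case base
        then show ?case using k by (auto simp: less_2_cases_iff)
      next
        case (step m)
        then show ?case using Nw[of m] by (auto simp: N_def)
      qed
      from this[of "length w - 1"] k have *: "\<forall>i<2. last w ! i = None"
        by (cases w) (auto simp: last_conv_nth)
      have "length (last w) = 2"
        using w k by (cases w rule: rev_cases) (auto simp: B_def conv_alphabet_def)
      then have "last w = [None, None]"
        using * by (intro nth_equalityI) (auto simp: less_2_cases_iff)
      then show False using w k by auto
    qed
  qed
  have R: "?R \<subseteq> {ws. length ws = 2 \<and> set ws \<subseteq> lists A}"
    by (auto simp: normal_words_def)
  have "convolution ` ?R = L"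
  proof (intro equalityI subsetI)
    fix w assume "w \<in> convolution ` ?R"
    then obtain u v where "w = convolution [u, v]" "[u, v] \<in> ?R" by blast
    moreover from this have "u \<in> lists A" "v \<in> lists A"
      by (auto simp: normal_words_def)
    ultimately show "w \<in> L" using L by blast
  next
    fix w assume "w \<in> L"
    then obtain u v where "u \<in> lists A" "v \<in> lists A" "w = convolution [u, v]"
      using ex by blast
    with L \<open>w \<in> L\<close> have "[u, v] \<in> ?R" by blast
    with \<open>w = convolution [u, v]\<close> show "w \<in> convolution ` ?R" by (rule image_eqI)
  qed
  moreover have "regular_language B L"
    unfolding L_def B_def by (intro regular_pad_local finite_conv_alphabet assms)
  ultimately show ?thesis using R by (simp add: FA_recognizable_def B_def)
qed

section \<open>Sequences over the integers\<close>

text \<open>A sequence over the integers is folded at \<open>0\<close>: the letter at \<open>k\<close> carries the entries at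
  \<open>k\<close> (decoded by \<open>r\<close>) and at \<open>- k - 1\<close> (decoded by \<open>l\<close>).\<close>

definition two_sided :: "('b \<Rightarrow> 's) \<Rightarrow> ('b \<Rightarrow> 's) \<Rightarrow> (nat \<Rightarrow> 'b) \<Rightarrow> int \<Rightarrow> 's" where
  "two_sided l r s j = (if 0 \<le> j then r (s (nat j)) else l (s (nat (- j - 1))))"

text \<open>The two ends have separate default values because the flag of a code is true far to the
  left and false far to the right.\<close>

definition biseqs :: "'s set \<Rightarrow> 's \<Rightarrow> 's \<Rightarrow> (int \<Rightarrow> 's) set" where
  "biseqs S dm dp =
    {p. range p \<subseteq> S \<and> finite {j. j < 0 \<and> p j \<noteq> dm} \<and> finite {j. 0 \<le> j \<and> p j \<noteq> dp}}"

lemma two_sided_int: "two_sided l r s (int k) = r (s k)" "two_sided l r s (- int k - 1) = l (s k)"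
  by (auto simp: two_sided_def)

text \<open>A letter amounts to a pair of entries, and \<open>d\<close> to the pair of defaults.
  Hence a letter differs from \<open>d\<close> exactly when one of its two entries differs from its
  default, and finiteness transfers both ways.\<close>

lemma bij_betw_two_sided:
  assumes bij: "bij_betw (\<lambda>x. (l x, r x)) A (S \<times> S)" and d: "d \<in> A" "l d = dm" "r d = dp"
  shows "bij_betw (two_sided l r) {s. range s \<subseteq> A \<and> finite {k. s k \<noteq> d}} (biseqs S dm dp)"
proof (rule bij_betw_imageI)
  have lr: "x = y" if "x \<in> A" "y \<in> A" "l x = l y" "r x = r y" for x y
    using bij that by (auto simp: bij_betw_def inj_on_def)
  have lrS: "l x \<in> S" "r x \<in> S" if "x \<in> A" for x
    using bij_betwE[OF bij] that by auto
  show "inj_on (two_sided l r) {s. range s \<subseteq> A \<and> finite {k. s k \<noteq> d}}"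
  proof (rule inj_onI)
    fix s t
    assume "s \<in> {s. range s \<subseteq> A \<and> finite {k. s k \<noteq> d}}" "t \<in> {s. range s \<subseteq> A \<and> finite {k. s k \<noteq> d}}"
      and eq: "two_sided l r s = two_sided l r t"
    then have A: "s k \<in> A" "t k \<in> A" for k by auto
    show "s = t"
    proof
      fix k
      show "s k = t k"
        using A fun_cong[OF eq, of "int k"] fun_cong[OF eq, of "- int k - 1"]
        by (intro lr) (simp_all add: two_sided_int)
    qed
  qed
  show "two_sided l r ` {s. range s \<subseteq> A \<and> finite {k. s k \<noteq> d}} = biseqs S dm dp"
  proof (intro equalityI subsetI)
    fix p assume "p \<in> two_sided l r ` {s. range s \<subseteq> A \<and> finite {k. s k \<noteq> d}}"
    then obtain s where s: "range s \<subseteq> A" "finite {k. s k \<noteq> d}" "p = two_sided l r s" by auto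
    have "{j. 0 \<le> j \<and> p j \<noteq> dp} \<subseteq> int ` {k. s k \<noteq> d}"
    proof
      fix j assume j: "j \<in> {j. 0 \<le> j \<and> p j \<noteq> dp}"
      then have "s (nat j) \<noteq> d" using d by (auto simp: s two_sided_def)
      then show "j \<in> int ` {k. s k \<noteq> d}" using j by (intro image_eqI[of _ _ "nat j"]) auto
    qed
    moreover have "{j. j < 0 \<and> p j \<noteq> dm} \<subseteq> (\<lambda>k. - int k - 1) ` {k. s k \<noteq> d}"
    proof
      fix j assume j: "j \<in> {j. j < 0 \<and> p j \<noteq> dm}"
      then have "s (nat (- j - 1)) \<noteq> d" using d by (auto simp: s two_sided_def)
      then show "j \<in> (\<lambda>k. - int k - 1) ` {k. s k \<noteq> d}"
        using j by (intro image_eqI[of _ _ "nat (- j - 1)"]) auto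
    qed
    moreover have "range p \<subseteq> S"
      using s lrS by (auto simp: two_sided_def)
    ultimately show "p \<in> biseqs S dm dp"
      using s(2) by (auto simp: biseqs_def intro: finite_subset)
  next
    fix p assume p: "p \<in> biseqs S dm dp"
    have "\<forall>k. \<exists>x\<in>A. l x = p (- int k - 1) \<and> r x = p (int k)"
    proof
      fix k
      have "(p (- int k - 1), p (int k)) \<in> S \<times> S"
        using p by (auto simp: biseqs_def)
      then show "\<exists>x\<in>A. l x = p (- int k - 1) \<and> r x = p (int k)"
        unfolding bij_betw_imp_surj_on[OF bij, symmetric] by (auto simp: eq_commute)
    qed
    then obtain s where s: "\<And>k. s k \<in> A" "\<And>k. l (s k) = p (- int k - 1)" "\<And>k. r (s k) = p (int k)"
      by metis
    have "{k. s k \<noteq> d} \<subseteq> nat ` {j. 0 \<le> j \<and> p j \<noteq> dp} \<union> (\<lambda>j. nat (- j - 1)) ` {j. j < 0 \<and> p j \<noteq> dm}"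
    proof
      fix k assume "k \<in> {k. s k \<noteq> d}"
      then have "p (int k) \<noteq> dp \<or> p (- int k - 1) \<noteq> dm"
        using lr[of "s k" d] s[of k] d by auto
      then show "k \<in> nat ` {j. 0 \<le> j \<and> p j \<noteq> dp} \<union> (\<lambda>j. nat (- j - 1)) ` {j. j < 0 \<and> p j \<noteq> dm}"
      proof
        assume "p (int k) \<noteq> dp"
        then show ?thesis by (intro UnI1 image_eqI[of _ _ "int k"]) auto
      next
        assume "p (- int k - 1) \<noteq> dm"
        then show ?thesis by (intro UnI2 image_eqI[of _ _ "- int k - 1"]) auto
      qed
    qed
    then have "finite {k. s k \<noteq> d}"
      by (rule finite_subset) (use p in \<open>simp add: biseqs_def\<close>)
    moreover have "two_sided l r s = p"
      using s by (auto simp: two_sided_def fun_eq_iff)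
    ultimately show "p \<in> two_sided l r ` {s. range s \<subseteq> A \<and> finite {k. s k \<noteq> d}}"
      using s(1) by blast
  qed
qed

text \<open>Neighbouring integers lie in the same half or are \<open>-1\<close> and
  \<open>0\<close>. The latter two share letter \<open>0\<close>, so the seam is a condition on that
  letter alone; in the left half the order of neighbours is reversed.\<close>

lemma two_sided_local:
  "(\<forall>j. Q (two_sided l r s j) (two_sided l r s (j + 1))) \<longleftrightarrow>
    Q (l (s 0)) (r (s 0)) \<and>
    (\<forall>k. Q (r (s k)) (r (s (Suc k))) \<and> Q (l (s (Suc k))) (l (s k)))" (is "?l \<longleftrightarrow> ?r")
proof
  assume l: ?l
  have "Q (r (s k)) (r (s (Suc k)))" for k
    using spec[OF l, of "int k"] by (simp add: two_sided_def nat_add_distrib)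
  moreover have "Q (l (s (Suc k))) (l (s k))" for k
  proof -
    have "- int (Suc k) - 1 + 1 = - int k - 1" by simp
    with spec[OF l, of "- int (Suc k) - 1"] show ?thesis by (simp only: two_sided_int)
  qed
  ultimately show ?r
    using spec[OF l, of "-1"] by (simp add: two_sided_def)
next
  assume r: ?r
  show ?l
  proof
    fix j :: int
    consider k where "j = int k" | "j = -1" | k where "j = - int (Suc k) - 1"
    proof -
      have "j = int (nat j) \<or> j = -1 \<or> j = - int (Suc (nat (- j - 2))) - 1" by linarith
      then show thesis using that by blast
    qed
    then show "Q (two_sided l r s j) (two_sided l r s (j + 1))"
    proof cases
      case (1 k)
      then show ?thesis using r by (simp add: two_sided_def nat_add_distrib)
    next
      case 2
      then show ?thesis using r by (simp add: two_sided_def)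
    next
      case (3 k)
      then have "j + 1 = - int k - 1" by simp
      then show ?thesis unfolding \<open>j + 1 = - int k - 1\<close> unfolding 3 two_sided_int using r by blast
    qed
  qed
qed

text \<open>The criterion applied to the wreath product: if both the codes and the edges are
  described by conditions on neighbouring entries, folding turns these into conditions on
  consecutive letters, which automata check.\<close>

lemma graph_automatic_wrt_biseqs:
  fixes W :: "('g, 'b) monoid_scheme" and code :: "'g \<Rightarrow> int \<Rightarrow> 's"
  assumes W: "group W" "finite X" "X \<subseteq> carrier W" "generate W X = carrier W"
    and S: "finite S" "dm \<in> S" "dp \<in> S"
    and inj: "inj_on code (carrier W)"
    and range: "code ` carrier W = {p \<in> biseqs S dm dp. \<forall>j. V (p j) (p (j + 1))}"
    and edge: "\<And>x. x \<in> X \<Longrightarrow> \<exists>Q. \<forall>g\<in>carrier W. \<forall>h\<in>carrier W.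
      g \<otimes>\<^bsub>W\<^esub> x = h \<longleftrightarrow> (\<forall>j. Q (code g j, code h j) (code g (j + 1), code h (j + 1)))"
  shows "graph_automatic_wrt W X"
proof -
  \<comment> \<open>The alphabet must consist of natural numbers, so the pairs of entries are
    enumerated.\<close>
  obtain \<pi> :: "nat \<Rightarrow> 's \<times> 's" where \<pi>: "bij_betw \<pi> {0..<card (S \<times> S)} (S \<times> S)"
    using ex_bij_betw_nat_finite[of "S \<times> S"] S by auto
  define A where "A = {0..<card (S \<times> S)}"
  define l where "l = fst \<circ> \<pi>"
  define r where "r = snd \<circ> \<pi>"
  have lr: "bij_betw (\<lambda>x. (l x, r x)) A (S \<times> S)"
    using \<pi> by (simp add: A_def l_def r_def)
  have "(dm, dp) \<in> (\<lambda>x. (l x, r x)) ` A"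
    using lr S by (simp add: bij_betw_def)
  then obtain d where d: "d \<in> A" "l d = dm" "r d = dp" by auto
  have A: "finite A" by (simp add: A_def)
  define \<phi> where "\<phi> = two_sided l r \<circ> pad d"
  have \<phi>: "bij_betw \<phi> (normal_words A d) (biseqs S dm dp)"
    unfolding \<phi>_def by (rule bij_betw_trans[OF bij_betw_pad[OF d(1)] bij_betw_two_sided[OF lr d]])
  define R where "R = {w \<in> normal_words A d. \<forall>j. V (\<phi> w j) (\<phi> w (j + 1))}"
  have "bij_betw \<phi> R (code ` carrier W)"
  proof (rule bij_betw_subset[OF \<phi>])
    show "R \<subseteq> normal_words A d" by (auto simp: R_def)
    show "\<phi> ` R = code ` carrier W"
      unfolding range using \<phi> by (auto simp: R_def bij_betw_def)
  qed
  moreover define \<nu> where "\<nu> = inv_into (carrier W) code \<circ> \<phi>"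
  ultimately have \<nu>: "bij_betw \<nu> R (carrier W)"
    using bij_betw_trans bij_betw_inv_into[OF inj_on_imp_bij_betw[OF inj]] by blast
  have code: "code (\<nu> u) = \<phi> u" if "u \<in> R" for u
    using that \<open>bij_betw \<phi> R (code ` carrier W)\<close>
    by (auto simp: \<nu>_def bij_betw_def intro!: f_inv_into_f)
  have "regular_language A R"
  proof -
    have "R = {w \<in> normal_words A d. V (l (pad d w 0)) (r (pad d w 0)) \<and>
        (\<forall>k. V (r (pad d w k)) (r (pad d w (Suc k))) \<and> V (l (pad d w (Suc k))) (l (pad d w k)))}"
      by (simp add: R_def \<phi>_def two_sided_local)
    then show ?thesis
      using regular_pad_local[OF A, of d "\<lambda>x. V (l x) (r x)"
          "\<lambda>x y. V (r x) (r y) \<and> V (l y) (l x)"] by simp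
  qed
  moreover have "FA_recognizable A 2 {[u, v] | u v. u \<in> R \<and> v \<in> R \<and> \<nu> u \<otimes>\<^bsub>W\<^esub> x = \<nu> v}"
    if "x \<in> X" for x
  proof -
    obtain Q where Q: "\<And>g h. g \<in> carrier W \<Longrightarrow> h \<in> carrier W \<Longrightarrow>
        g \<otimes>\<^bsub>W\<^esub> x = h \<longleftrightarrow> (\<forall>j. Q (code g j, code h j) (code g (j + 1), code h (j + 1)))"
      using edge[OF \<open>x \<in> X\<close>] by blast
    \<comment> \<open>Adding \<open>V\<close> for both tracks absorbs membership of both words in
      \<open>R\<close> into the local condition.\<close>
    define T where "T a b \<longleftrightarrow> V (fst a) (fst b) \<and> V (snd a) (snd b) \<and> Q a b" for a b
    \<comment> \<open>Folding commutes with pairing, so \<open>two_sided_local\<close> applies to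
      the pair as a single sequence.\<close>
    have pair: "(\<phi> u j, \<phi> v j) =
        two_sided (map_prod l l) (map_prod r r) (\<lambda>k. (pad d u k, pad d v k)) j" for u v j
      by (simp add: \<phi>_def two_sided_def)
    have iff: "u \<in> R \<and> v \<in> R \<and> \<nu> u \<otimes>\<^bsub>W\<^esub> x = \<nu> v \<longleftrightarrow>
        u \<in> normal_words A d \<and> v \<in> normal_words A d \<and>
        (\<forall>j. T (\<phi> u j, \<phi> v j) (\<phi> u (j + 1), \<phi> v (j + 1)))" for u v
    proof (cases "u \<in> R \<and> v \<in> R")
      case True
      then have "\<nu> u \<in> carrier W" "\<nu> v \<in> carrier W"
        using \<nu> by (auto simp: bij_betw_def)
      then show ?thesis using True Q code by (auto simp: T_def R_def)
    next
      case False
      then show ?thesis by (auto simp: T_def R_def)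
    qed
    show ?thesis
      unfolding iff pair two_sided_local
      by (rule FA_recognizable_pad_local[OF A, of d
            "\<lambda>a. T (map_prod l l a) (map_prod r r a)"
            "\<lambda>a b. T (map_prod r r a) (map_prod r r b) \<and> T (map_prod l l b) (map_prod l l a)"])
  qed
  ultimately show ?thesis
    unfolding graph_automatic_wrt_def using W A \<nu> by blast
qed

section \<open>The wreath product\<close>

abbreviation (input) shift_elem :: "('a, 'b) monoid_scheme \<Rightarrow> int \<Rightarrow> int \<times> (int \<Rightarrow> 'a)" where
  "shift_elem G i \<equiv> (i, \<lambda>_. \<one>\<^bsub>G\<^esub>)"

abbreviation (input) lamp_elem :: "('a, 'b) monoid_scheme \<Rightarrow> int \<Rightarrow> 'a \<Rightarrow> int \<times> (int \<Rightarrow> 'a)" where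
  "lamp_elem G k a \<equiv> (0, (\<lambda>_. \<one>\<^bsub>G\<^esub>)(k := a))"

lemma restricted_wreath_int_simps:
  "x \<in> carrier (restricted_wreath_int G) \<longleftrightarrow>
    (\<forall>j. snd x j \<in> carrier G) \<and> finite {j. snd x j \<noteq> \<one>\<^bsub>G\<^esub>}"
  "(i, f) \<otimes>\<^bsub>restricted_wreath_int G\<^esub> (i', f') = (i + i', \<lambda>j. f (j + i') \<otimes>\<^bsub>G\<^esub> f' j)"
  "\<one>\<^bsub>restricted_wreath_int G\<^esub> = (0, \<lambda>_. \<one>\<^bsub>G\<^esub>)"
  by (auto simp: restricted_wreath_int_def)

lemma finite_shift:
  fixes i :: int
  assumes "finite {j. P j}"
  shows "finite {j. P (j + i)}"
proof -
  have "{j. P (j + i)} \<subseteq> (\<lambda>j. j - i) ` {j. P j}"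
    by (auto intro!: image_eqI[of _ _ "_ + i"])
  then show ?thesis using assms by (meson finite_imageI finite_subset)
qed

lemma group_restricted_wreath_int:
  assumes "group G"
  shows "group (restricted_wreath_int G)"
proof -
  interpret group G by fact
  show ?thesis
  proof (rule groupI, goal_cases)
    case (1 x y)
    obtain i f i' f' where xy: "x = (i, f)" "y = (i', f')" by force
    have "{j. f (j + i') \<otimes>\<^bsub>G\<^esub> f' j \<noteq> \<one>\<^bsub>G\<^esub>} \<subseteq> {j. f (j + i') \<noteq> \<one>\<^bsub>G\<^esub>} \<union> {j. f' j \<noteq> \<one>\<^bsub>G\<^esub>}"
      by auto
    moreover have "finite {j. f (j + i') \<noteq> \<one>\<^bsub>G\<^esub>}" "finite {j. f' j \<noteq> \<one>\<^bsub>G\<^esub>}"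
      using 1 xy by (auto simp: restricted_wreath_int_simps intro: finite_shift)
    ultimately have "finite {j. f (j + i') \<otimes>\<^bsub>G\<^esub> f' j \<noteq> \<one>\<^bsub>G\<^esub>}"
      by (meson finite_UnI finite_subset)
    then show ?case using 1 xy by (simp add: restricted_wreath_int_simps)
  next
    case 2
    then show ?case by (simp add: restricted_wreath_int_simps)
  next
    case (3 x y z)
    then show ?case
      by (cases x; cases y; cases z)
        (auto simp: restricted_wreath_int_simps m_assoc algebra_simps fun_eq_iff)
  next
    case (4 x)
    then show ?case by (cases x) (auto simp: restricted_wreath_int_simps)
  next
    case (5 x)
    obtain i f where x: "x = (i, f)" by force
    then have f: "\<And>j. f j \<in> carrier G" "finite {j. f j \<noteq> \<one>\<^bsub>G\<^esub>}"
      using 5 by (auto simp: restricted_wreath_int_simps)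
    have "{j. inv\<^bsub>G\<^esub> (f (j - i)) \<noteq> \<one>\<^bsub>G\<^esub>} = {j. f (j - i) \<noteq> \<one>\<^bsub>G\<^esub>}"
      using f by simp
    then have "finite {j. inv\<^bsub>G\<^esub> (f (j - i)) \<noteq> \<one>\<^bsub>G\<^esub>}"
      using finite_shift[OF f(2), of "- i"] by simp
    \<comment> \<open>The shift by \<open>- i\<close> cancels the shift by \<open>i\<close> that the
      product applies to the left factor.\<close>
    then have "(- i, \<lambda>j. inv\<^bsub>G\<^esub> (f (j - i))) \<in> carrier (restricted_wreath_int G)"
      using f by (simp add: restricted_wreath_int_simps)
    moreover have "(- i, \<lambda>j. inv\<^bsub>G\<^esub> (f (j - i))) \<otimes>\<^bsub>restricted_wreath_int G\<^esub> x =
        \<one>\<^bsub>restricted_wreath_int G\<^esub>"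
      using f x by (simp add: restricted_wreath_int_simps)
    ultimately show ?case by blast
  qed
qed

section \<open>Generators of the wreath product\<close>

definition lamplighter_gens :: "('a, 'b) monoid_scheme \<Rightarrow> (int \<times> (int \<Rightarrow> 'a)) set" where
  "lamplighter_gens G = insert (shift_elem G 1) (lamp_elem G 0 ` carrier G)"

lemma lamplighter_gens_subset:
  assumes "group G"
  shows "lamplighter_gens G \<subseteq> carrier (restricted_wreath_int G)"
proof -
  interpret group G by fact
  have "finite {j::int. ((\<lambda>_. \<one>\<^bsub>G\<^esub>)(0 := a)) j \<noteq> \<one>\<^bsub>G\<^esub>}" for a
    by (rule finite_subset[of _ "{0::int}"]) auto
  then show ?thesis
    by (auto simp: lamplighter_gens_def restricted_wreath_int_simps simp del: fun_upd_apply)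
       (auto)
qed

text \<open>Conjugation by shifts carries the lamp at \<open>0\<close> to every position, products
  of lamps give all finitely supported functions, and \<open>(i, f)\<close> is a shift by
  \<open>i\<close> times \<open>(0, f)\<close>.\<close>

lemma generate_lamplighter_gens:
  assumes "group G"
  shows "generate (restricted_wreath_int G) (lamplighter_gens G) = carrier (restricted_wreath_int G)"
    (is "?H = carrier ?W")
proof
  interpret G: group G by fact
  interpret W: group ?W using group_restricted_wreath_int[OF assms] .
  show "?H \<subseteq> carrier ?W"
    using W.generate_incl[OF lamplighter_gens_subset[OF assms]] .
  interpret H: subgroup ?H ?W
    using W.generate_is_subgroup[OF lamplighter_gens_subset[OF assms]] .
  have shift_nat: "shift_elem G (int n) \<in> ?H" for n
  proof (induction n)
    case 0
    then show ?case using H.one_closed by (simp add: restricted_wreath_int_simps)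
  next
    case (Suc n)
    have "shift_elem G 1 \<in> ?H"
      by (rule generate.incl) (simp add: lamplighter_gens_def)
    from H.m_closed[OF Suc this] show ?case
      by (simp add: restricted_wreath_int_simps add.commute)
  qed
  have shift: "shift_elem G i \<in> ?H" for i
  proof (cases "0 \<le> i")
    case True
    then show ?thesis using shift_nat[of "nat i"] by simp
  next
    case False
    have "inv\<^bsub>?W\<^esub> (shift_elem G (- i)) = shift_elem G i"
      by (rule W.inv_equality) (simp_all add: restricted_wreath_int_simps)
    then show ?thesis using False H.m_inv_closed[OF shift_nat[of "nat (- i)"]] by simp
  qed
  have lamp: "lamp_elem G k a \<in> ?H" if "a \<in> carrier G" for k a
  proof -
    have "lamp_elem G 0 a \<in> ?H"
      by (rule generate.incl) (use that in \<open>simp add: lamplighter_gens_def\<close>)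
    from H.m_closed[OF H.m_closed[OF shift[of k] this] shift[of "- k"]]
    have "(0, \<lambda>j. ((\<lambda>_. \<one>\<^bsub>G\<^esub>)(0 := a)) (j - k)) \<in> ?H"
      using that by (simp add: restricted_wreath_int_simps if_distrib[of "\<lambda>b. b \<otimes>\<^bsub>G\<^esub> _"]
          cong: if_cong)
    moreover have "(\<lambda>j. ((\<lambda>_. \<one>\<^bsub>G\<^esub>)(0 := a)) (j - k)) = (\<lambda>_. \<one>\<^bsub>G\<^esub>)(k := a)"
      by auto
    ultimately show ?thesis by simp
  qed
  have base: "(0, f) \<in> ?H"
    if "finite D" "\<And>j. f j \<in> carrier G" "{j. f j \<noteq> \<one>\<^bsub>G\<^esub>} \<subseteq> D" for f D
    using that
  proof (induction D arbitrary: f rule: finite_induct)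
    case empty
    then have "f = (\<lambda>_. \<one>\<^bsub>G\<^esub>)" by auto
    then show ?case using shift[of 0] by simp
  next
    case (insert k D)
    \<comment> \<open>The entry at \<open>k\<close> is erased to shrink the support and then
      restored by a lamp at \<open>k\<close>.\<close>
    have "(0, f(k := \<one>\<^bsub>G\<^esub>)) \<in> ?H"
      using insert.prems by (intro insert.IH) auto
    from H.m_closed[OF this lamp[of "f k" k]]
    have "(0, \<lambda>j. (f(k := \<one>\<^bsub>G\<^esub>)) j \<otimes>\<^bsub>G\<^esub> ((\<lambda>_. \<one>\<^bsub>G\<^esub>)(k := f k)) j) \<in> ?H"
      using insert.prems by (simp add: restricted_wreath_int_simps)
    moreover have "(\<lambda>j. (f(k := \<one>\<^bsub>G\<^esub>)) j \<otimes>\<^bsub>G\<^esub> ((\<lambda>_. \<one>\<^bsub>G\<^esub>)(k := f k)) j) = f"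
      using insert.prems by auto
    ultimately show ?case by simp
  qed
  show "carrier ?W \<subseteq> ?H"
  proof
    fix x assume x: "x \<in> carrier ?W"
    obtain i f where "x = (i, f)" by force
    with x have f: "\<And>j. f j \<in> carrier G" "finite {j. f j \<noteq> \<one>\<^bsub>G\<^esub>}"
      by (auto simp: restricted_wreath_int_simps)
    from H.m_closed[OF shift[of i] base[OF f(2,1)]]
    show "x \<in> ?H" using f \<open>x = (i, f)\<close> by (simp add: restricted_wreath_int_simps)
  qed
qed

section \<open>Coding group elements by sequences over the integers\<close>

definition lamplighter_code :: "int \<times> (int \<Rightarrow> 'a) \<Rightarrow> int \<Rightarrow> 'a \<times> bool" where
  "lamplighter_code x j = (snd x (j - fst x), j < fst x)"

lemma inj_lamplighter_code: "inj lamplighter_code"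
proof (rule injI)
  fix x y :: "int \<times> (int \<Rightarrow> 'a)"
  assume eq: "lamplighter_code x = lamplighter_code y"
  have lt: "j < fst x \<longleftrightarrow> j < fst y" for j
    using fun_cong[OF eq, of j] by (simp add: lamplighter_code_def)
  have fst: "fst x = fst y"
    using lt[of "fst x"] lt[of "fst y"] by simp
  have "snd x j = snd y j" for j
    using fun_cong[OF eq, of "j + fst x"] fst by (simp add: lamplighter_code_def)
  with fst show "x = y" by (simp add: prod_eq_iff fun_eq_iff)
qed

text \<open>A flag that never reappears to the right, true far to the left and false far to the
  right, drops at exactly one place. That place is \<open>i\<close>, and \<open>f\<close> is read
  off relative to it.\<close>

lemma image_lamplighter_code:
  "lamplighter_code ` carrier (restricted_wreath_int G) =
    {p \<in> biseqs (carrier G \<times> UNIV) (\<one>\<^bsub>G\<^esub>, True) (\<one>\<^bsub>G\<^esub>, False).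
      \<forall>j. snd (p (j + 1)) \<longrightarrow> snd (p j)}"
proof (intro equalityI subsetI)
  fix p assume "p \<in> lamplighter_code ` carrier (restricted_wreath_int G)"
  then obtain i f where f: "\<And>j. f j \<in> carrier G" "finite {j. f j \<noteq> \<one>\<^bsub>G\<^esub>}"
    and p: "p = lamplighter_code (i, f)"
    by (force simp: restricted_wreath_int_simps)
  have fin: "finite {j. f (j - i) \<noteq> \<one>\<^bsub>G\<^esub>}"
    using finite_shift[OF f(2), of "- i"] by simp
  \<comment> \<open>A deviation comes from a nontrivial entry or from the flag dropping away from
    \<open>0\<close>, hence the interval between \<open>i\<close> and \<open>0\<close>.\<close>
  have "{j. j < 0 \<and> p j \<noteq> (\<one>\<^bsub>G\<^esub>, True)} \<subseteq> {j. f (j - i) \<noteq> \<one>\<^bsub>G\<^esub>} \<union> {i..<0}"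
    by (auto simp: p lamplighter_code_def)
  moreover have "{j. 0 \<le> j \<and> p j \<noteq> (\<one>\<^bsub>G\<^esub>, False)} \<subseteq> {j. f (j - i) \<noteq> \<one>\<^bsub>G\<^esub>} \<union> {0..<i}"
    by (auto simp: p lamplighter_code_def)
  ultimately have "finite {j. j < 0 \<and> p j \<noteq> (\<one>\<^bsub>G\<^esub>, True)}" "finite {j. 0 \<le> j \<and> p j \<noteq> (\<one>\<^bsub>G\<^esub>, False)}"
    using fin by (meson finite_UnI finite_atLeastLessThan_int finite_subset)+
  then show "p \<in> {p \<in> biseqs (carrier G \<times> UNIV) (\<one>\<^bsub>G\<^esub>, True) (\<one>\<^bsub>G\<^esub>, False).
      \<forall>j. snd (p (j + 1)) \<longrightarrow> snd (p j)}"
    using f by (auto simp: biseqs_def p lamplighter_code_def)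
next
  fix p
  assume p: "p \<in> {p \<in> biseqs (carrier G \<times> UNIV) (\<one>\<^bsub>G\<^esub>, True) (\<one>\<^bsub>G\<^esub>, False).
      \<forall>j. snd (p (j + 1)) \<longrightarrow> snd (p j)}"
  define M where "M = {j. j < 0 \<and> p j \<noteq> (\<one>\<^bsub>G\<^esub>, True)} \<union> {j. 0 \<le> j \<and> p j \<noteq> (\<one>\<^bsub>G\<^esub>, False)}"
  have M: "finite M" using p by (auto simp: M_def biseqs_def)
  have decr: "snd (p j)" if "j \<le> k" "snd (p k)" for j k
    using that(1)
  proof (induction j rule: int_le_induct)
    case (step i)
    then show ?case using p by (metis (mono_tags, lifting) diff_add_cancel mem_Collect_eq)
  qed (fact that(2))
  \<comment> \<open>Beyond distance \<open>b\<close> the sequence is at its defaults;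
    \<open>b\<close> is positive so that \<open>- b\<close> and \<open>b\<close> lie on different
    sides of the seam.\<close>
  obtain b where b: "\<And>j. j \<in> M \<Longrightarrow> \<bar>j\<bar> < b" "0 < b"
  proof
    show "\<bar>j\<bar> < Max (insert 0 (abs ` M)) + 1" if "j \<in> M" for j
      using M that by (intro zless_add1_eq[THEN iffD2] le_imp_less_or_eq Max_ge) auto
    show "0 < Max (insert 0 (abs ` M)) + 1"
      using M by (intro zle_add1_eq_le[THEN iffD2] Max_ge) auto
  qed
  have left: "snd (p j)" if "j \<le> - b" for j
    using b(1)[of j] b(2) that by (force simp: M_def)
  have right: "\<not> snd (p j)" if "b \<le> j" for j
    using b(1)[of j] b(2) that by (force simp: M_def)
  \<comment> \<open>One past the last flagged position; the maximum exists because
    \<open>- b\<close> is flagged.\<close>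
  define i where "i = Max {j \<in> {- b..b}. snd (p j)} + 1"
  have i: "i - 1 \<in> {j \<in> {- b..b}. snd (p j)}"
  proof -
    have "- b \<in> {j \<in> {- b..b}. snd (p j)}" using left[of "- b"] b by simp
    moreover have "finite {j \<in> {- b..b}. snd (p j)}" by (rule finite_Collect_conjI) simp
    ultimately have "Max {j \<in> {- b..b}. snd (p j)} \<in> {j \<in> {- b..b}. snd (p j)}"
      by (intro Max_in) blast+
    then show ?thesis by (simp add: i_def)
  qed
  have snd_p: "snd (p j) \<longleftrightarrow> j < i" for j
  proof
    assume j: "snd (p j)"
    show "j < i"
    proof (cases "j < - b")
      case False
      moreover have "j < b" using right[of j] j by (meson not_le)
      ultimately have "j \<in> {j \<in> {- b..b}. snd (p j)}" using j by simp
      moreover have "finite {j \<in> {- b..b}. snd (p j)}" by (rule finite_Collect_conjI) simp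
      ultimately have "j \<le> Max {j \<in> {- b..b}. snd (p j)}" by (intro Max_ge)
      then show ?thesis by (simp add: i_def)
    qed (use i in auto)
  next
    assume "j < i"
    then show "snd (p j)" using decr[of j "i - 1"] i by simp
  qed
  define f where "f j = fst (p (j + i))" for j
  have "{j. fst (p j) \<noteq> \<one>\<^bsub>G\<^esub>} \<subseteq> M"
    by (auto simp: M_def)
  then have "finite {j. f j \<noteq> \<one>\<^bsub>G\<^esub>}"
    unfolding f_def using M by (intro finite_shift) (rule finite_subset)
  moreover have "f j \<in> carrier G" for j
    using p by (auto simp: f_def biseqs_def image_subset_iff mem_Times_iff)
  ultimately have "(i, f) \<in> carrier (restricted_wreath_int G)"
    by (simp add: restricted_wreath_int_simps)
  moreover have "p = lamplighter_code (i, f)"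
    using snd_p by (auto simp: lamplighter_code_def f_def prod_eq_iff fun_eq_iff)
  ultimately show "p \<in> lamplighter_code ` carrier (restricted_wreath_int G)" by blast
qed

theorem theorem10p6:
  fixes G :: "('a, 'b) monoid_scheme"
  assumes "group G" and "finite (carrier G)"
  shows "graph_automatic (restricted_wreath_int G)"
proof -
  let ?W = "restricted_wreath_int G"
  interpret group G by fact
  have code_eq: "g = h \<longleftrightarrow> (\<forall>j. lamplighter_code g j = lamplighter_code h j)"
    for g h :: "int \<times> (int \<Rightarrow> 'a)"
    using inj_lamplighter_code by (metis ext injD)
  have "\<exists>Q. \<forall>g\<in>carrier ?W. \<forall>h\<in>carrier ?W. g \<otimes>\<^bsub>?W\<^esub> x = h \<longleftrightarrow>
      (\<forall>j. Q (lamplighter_code g j, lamplighter_code h j)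
             (lamplighter_code g (j + 1), lamplighter_code h (j + 1)))"
    if x: "x \<in> lamplighter_gens G" for x
  proof (cases "x = shift_elem G 1")
    case True
    \<comment> \<open>The entries stay, and the new flag at \<open>j + 1\<close> is the old one at
      \<open>j\<close>.\<close>
    define Q :: "('a \<times> bool) \<times> 'a \<times> bool \<Rightarrow> ('a \<times> bool) \<times> 'a \<times> bool \<Rightarrow> bool"
      where "Q = (\<lambda>(p, q) (p', q'). q' = (fst p', snd p))"
    have "g \<otimes>\<^bsub>?W\<^esub> x = h \<longleftrightarrow>
      (\<forall>j. Q (lamplighter_code g j, lamplighter_code h j)
             (lamplighter_code g (j + 1), lamplighter_code h (j + 1)))"
      if "g \<in> carrier ?W" for g h
    proof -
      have "lamplighter_code (g \<otimes>\<^bsub>?W\<^esub> x) (j + 1) =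
          (fst (lamplighter_code g (j + 1)), snd (lamplighter_code g j))" for j
        using that True
        by (cases g) (auto simp: restricted_wreath_int_simps lamplighter_code_def algebra_simps)
      \<comment> \<open>Every integer has the form \<open>j + 1\<close>, so comparing the codes at
        the right neighbours suffices.\<close>
      moreover have "g \<otimes>\<^bsub>?W\<^esub> x = h \<longleftrightarrow>
          (\<forall>j. lamplighter_code (g \<otimes>\<^bsub>?W\<^esub> x) (j + 1) = lamplighter_code h (j + 1))"
        unfolding code_eq by (metis diff_add_cancel)
      ultimately show ?thesis by (auto simp: Q_def)
    qed
    then show ?thesis by blast
  next
    case False
    then obtain a where a: "a \<in> carrier G" "x = lamp_elem G 0 a"
      using x by (auto simp: lamplighter_gens_def)
    \<comment> \<open>The lamp acts at the unique position that is unflagged while its left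
      neighbour is flagged, so a window of two entries locates it.\<close>
    define Q :: "('a \<times> bool) \<times> 'a \<times> bool \<Rightarrow> ('a \<times> bool) \<times> 'a \<times> bool \<Rightarrow> bool"
      where "Q = (\<lambda>(p, q) (p', q').
        q' = (if snd p \<and> \<not> snd p' then fst p' \<otimes>\<^bsub>G\<^esub> a else fst p', snd p'))"
    have "g \<otimes>\<^bsub>?W\<^esub> x = h \<longleftrightarrow>
      (\<forall>j. Q (lamplighter_code g j, lamplighter_code h j)
             (lamplighter_code g (j + 1), lamplighter_code h (j + 1)))"
      if "g \<in> carrier ?W" for g h
    proof -
      have "lamplighter_code (g \<otimes>\<^bsub>?W\<^esub> x) (j + 1) =
          (if snd (lamplighter_code g j) \<and> \<not> snd (lamplighter_code g (j + 1))
           then fst (lamplighter_code g (j + 1)) \<otimes>\<^bsub>G\<^esub> a else fst (lamplighter_code g (j + 1)),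
           snd (lamplighter_code g (j + 1)))" for j
        using that a
        by (cases g) (auto simp: restricted_wreath_int_simps lamplighter_code_def algebra_simps)
      moreover have "g \<otimes>\<^bsub>?W\<^esub> x = h \<longleftrightarrow>
          (\<forall>j. lamplighter_code (g \<otimes>\<^bsub>?W\<^esub> x) (j + 1) = lamplighter_code h (j + 1))"
        unfolding code_eq by (metis diff_add_cancel)
      ultimately show ?thesis by (auto simp: Q_def)
    qed
    then show ?thesis by blast
  qed
  then have "graph_automatic_wrt ?W (lamplighter_gens G)"
    using assms
    by (intro graph_automatic_wrt_biseqs[where code = lamplighter_code
          and S = "carrier G \<times> UNIV" and dm = "(\<one>\<^bsub>G\<^esub>, True)" and dp = "(\<one>\<^bsub>G\<^esub>, False)"
          and V = "\<lambda>a b. snd b \<longrightarrow> snd a"]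
        group_restricted_wreath_int lamplighter_gens_subset generate_lamplighter_gens
        inj_on_subset[OF inj_lamplighter_code] image_lamplighter_code)
      (auto simp: lamplighter_gens_def)
  then show ?thesis unfolding graph_automatic_def by blast
qed

end
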